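(* Let $(\mathcal T_\ell)_{\ell\in\mathbb N_0}$ be the sequence of meshes generated by the goal-oriented adaptive algorithm using Marking Strategy A or Marking Strategy B. Suppose that the error estimators $\eta$ and $\zeta$ satisfy stability on non-refined elements and reduction on refined elements. Suppose further that the refinement strategy has the marking property and the child property. Then a priori convergence of $(u_\ell)_{\ell\in\mathbb N_0}$ and $(z_\ell)_{\ell\in\mathbb N_0}$, i.e., existence of $u_\infty,z_\infty\in X$ with $\|u_\infty-u_\ell\|_X\to0$ and $\|z_\infty-z_\ell\|_X\to0$ as $\ell\to\infty$, implies $$\eta_\ell\,\zeta_\ell\to0\qquad\text{as }\ell\to\infty .$$
   Context: General setting. $\Omega\subset\mathbb R^d$, $d\ge1$, is a bounded Lipschitz domain, $|\cdot|$ is the Lebesgue measure, $|\Omega|>0$, and $X$ is a normed space of functions on $\Omega$. A mesh is a finite set $\mathcal T$ of compact subsets $T\subseteq\overline\Omega$ (elements) with $|T|>0$, $|T\cap T'|=0$ for distinct $T,T'\in\mathcal T$, and $\bigcup\mathcal T=\overline\Omega$. A refinement strategy is a fixed map that assigns to a mesh $\mathcal T_H$ and a set $\mathcal M_H\subseteq\mathcal T_H$ of marked elements a mesh $\mathrm{refine}(\mathcal T_H,\mathcal M_H)$. $\mathbb T(\mathcal T_H)$ denotes the set of all meshes obtained from $\mathcal T_H$ by finitely many refinement steps with arbitrary sets of marked elements; $\mathcal T_0$ is a fixed initial mesh and $\mathbb T:=\mathbb T(\mathcal T_0)$. To every $\mathcal T_H\in\mathbb T$ are associated a discrete subspace $X_H\subset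 X$, functions $u_H,z_H\in X_H$, and refinement indicators $\eta_H(T),\zeta_H(T)\ge0$ for $T\in\mathcal T_H$. For $\xi\in\{\eta,\zeta\}$ and $\mathcal U_H\subseteq\mathcal T_H$ put $\xi_H(\mathcal U_H):=\big(\sum_{T\in\mathcal U_H}\xi_H(T)^2\big)^{1/2}$ and $\xi_H:=\xi_H(\mathcal T_H)$. Objects belonging to $\mathcal T_h$, $\mathcal T_\ell$ carry the index $h$, $\ell$. Further, $u\in X$ is fixed (exact solution), $G:X\to\mathbb R$ is continuous, and there are $G_H\in\mathbb R$ and a constant $C_{\rm go}>0$ with $|G(u)-G_H|\le C_{\rm go}\,\eta_H\zeta_H$ for all $\mathcal T_H\in\mathbb T$. Algorithm. Starting from $\mathcal T_0$, for $\ell=0,1,2,\dots$: compute $u_\ell,z_\ell$ and $\eta_\ell(T),\zeta_\ell(T)$; choose $\mathcal M_\ell\subseteq\mathcal T_\ell$ by the marking strategy; set $\mathcal T_{\ell+1}:=\mathrm{refine}(\mathcal T_\ell,\mathcal M_\ell)$. If $\eta_{\ell_0}\zeta_{\ell_0}=0$ for some minimal $\ell_0$, the algorithm stops and one sets $\mathcal T_\ell:=\mathcal T_{\ell_0}$ for $\ell\ge\ell_0$. Marking Strategy A: with a fixed function $V:\mathbb R_{\ge0}^2\to\mathbb R_{\ge0}$ that is continuous at $(0,0)$ with $V(0,0)=0$, choose $\mathcal M_H\subseteq\mathcal T_H$ such that $\big[\max_{T\in\mathcal T_H\setminus\mathcal M_H}\eta_H(T)\big]\big[\max_{T\in\mathcal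 T_H\setminus\mathcal M_H}\zeta_H(T)\big]\le V(\eta_H(\mathcal M_H),\zeta_H(\mathcal M_H))$ (maximum over the empty set is $0$). Marking Strategy B: with a fixed $\theta\in(0,1]$ and a fixed function $W:\mathbb R_{\ge0}^2\to\mathbb R_{\ge0}$ with $W(1,1)=1$ and $W(x,y)\le C_W\max\{x,y\}$ for all $x,y\in[0,1]$, where $C_W>0$ is a constant, choose $\mathcal M_H\subseteq\mathcal T_H$ such that $0<\theta\le W\big(\eta_H(\mathcal M_H)^2/\eta_H^2,\ \zeta_H(\mathcal M_H)^2/\zeta_H^2\big)$. Properties of the refinement strategy. For all $\mathcal T_H\in\mathbb T$, $\mathcal M_H\subseteq\mathcal T_H$, $\mathcal T_h:=\mathrm{refine}(\mathcal T_H,\mathcal M_H)$: - marking property: $\mathcal M_H\subseteq\mathcal T_H\setminus\mathcal T_h$; - child property: $T=\bigcup\{T'\in\mathcal T_h:T'\subseteq T\}$ for all $T\in\mathcal T_H$. Estimator properties. Let $0<q_{\rm red}<1$ and let $S:\mathbb R_{\ge0}^2\to\mathbb R_{\ge0}$ be continuous at $(0,0)$ with $S(0,0)=0$ and bounded on compact subsets of $\mathbb R_{\ge0}^2$. For $\xi\in\{\eta,\zeta\}$, all $\mathcal T_H\in\mathbb T$ and $\mathcal T_h\in\mathbb T(\mathcal T_H)$: - stability on non-refined elements: $\xi_h(\mathcal T_h\cap\mathcal T_H)\le\xi_H(\mathcal T_h\cap\mathcal T_H)+S(\|u_h-u_H\|_X,\|z_h-z_H\|_X)$; - reduction on refined elements: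 $\xi_h(\mathcal T_h\setminus\mathcal T_H)^2\le q_{\rm red}\,\xi_H(\mathcal T_H\setminus\mathcal T_h)^2+S(\|u_h-u_H\|_X,\|z_h-z_H\|_X)^2$. *)

theory Defs
  imports "HOL-Analysis.Analysis"
begin

section \<open>Domain and meshes\<close>

text \<open>Near every boundary point the domain is, after choosing a suitable unit direction \<open>e\<close>,
  the open region above the graph of a Lipschitz function on the hyperplane orthogonal to \<open>e\<close>.\<close>

definition bounded_lipschitz_domain :: "'a::euclidean_space set \<Rightarrow> bool" where
  "bounded_lipschitz_domain \<Omega> \<longleftrightarrow>
     \<Omega> \<noteq> {} \<and> open \<Omega> \<and> connected \<Omega> \<and> bounded \<Omega> \<and>
     (\<forall>x\<in>frontier \<Omega>. \<exists>U e g L. open U \<and> x \<in> U \<and> norm e = 1 \<and>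
        L-lipschitz_on {y. y \<bullet> e = 0} g \<and>
        \<Omega> \<inter> U = {y \<in> U. g (y - (y \<bullet> e) *\<^sub>R e) < y \<bullet> e})"

definition mesh :: "'a::euclidean_space set \<Rightarrow> 'a set set \<Rightarrow> bool" where
  "mesh \<Omega> \<T> \<longleftrightarrow>
     finite \<T> \<and>
     (\<forall>T\<in>\<T>. compact T \<and> T \<subseteq> closure \<Omega> \<and> measure lebesgue T > 0) \<and>
     (\<forall>T\<in>\<T>. \<forall>T'\<in>\<T>. T \<noteq> T' \<longrightarrow> measure lebesgue (T \<inter> T') = 0) \<and>
     \<Union>\<T> = closure \<Omega>"

definition refinement_strategy ::
  "'a::euclidean_space set \<Rightarrow> ('a set set \<Rightarrow> 'a set set \<Rightarrow> 'a set set) \<Rightarrow> bool" where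
  "refinement_strategy \<Omega> refine \<longleftrightarrow>
     (\<forall>\<T> \<M>. mesh \<Omega> \<T> \<longrightarrow> \<M> \<subseteq> \<T> \<longrightarrow> mesh \<Omega> (refine \<T> \<M>))"

inductive_set refinements ::
  "('a set set \<Rightarrow> 'a set set \<Rightarrow> 'a set set) \<Rightarrow> 'a set set \<Rightarrow> 'a set set set"
  for refine :: "'a set set \<Rightarrow> 'a set set \<Rightarrow> 'a set set" and \<T> :: "'a set set" where
  base: "\<T> \<in> refinements refine \<T>"
| step: "\<T>' \<in> refinements refine \<T> \<Longrightarrow> \<M> \<subseteq> \<T>' \<Longrightarrow> refine \<T>' \<M> \<in> refinements refine \<T>"

definition marking_property ::
  "('a set set \<Rightarrow> 'a set set \<Rightarrow> 'a set set) \<Rightarrow> 'a set set \<Rightarrow> bool" where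
  "marking_property refine \<T>\<^sub>0 \<longleftrightarrow>
     (\<forall>\<T> \<in> refinements refine \<T>\<^sub>0. \<forall>\<M>. \<M> \<subseteq> \<T> \<longrightarrow> \<M> \<subseteq> \<T> - refine \<T> \<M>)"

definition child_property ::
  "('a set set \<Rightarrow> 'a set set \<Rightarrow> 'a set set) \<Rightarrow> 'a set set \<Rightarrow> bool" where
  "child_property refine \<T>\<^sub>0 \<longleftrightarrow>
     (\<forall>\<T> \<in> refinements refine \<T>\<^sub>0. \<forall>\<M>. \<M> \<subseteq> \<T> \<longrightarrow>
        (\<forall>T\<in>\<T>. T = \<Union>{T' \<in> refine \<T> \<M>. T' \<subseteq> T}))"

section \<open>Estimators\<close>

text \<open>An indicator \<open>\<xi>\<close> takes a mesh and an element of it, so \<open>\<xi> \<T> T\<close> is the indicator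
  of the element \<open>T\<close> with respect to the mesh \<open>\<T>\<close>.\<close>

type_synonym 'a indicator_family = "'a set set \<Rightarrow> 'a set \<Rightarrow> real"

definition est :: "'a indicator_family \<Rightarrow> 'a set set \<Rightarrow> 'a set set \<Rightarrow> real" where
  "est \<xi> \<T> \<U> = sqrt (\<Sum>T\<in>\<U>. (\<xi> \<T> T)\<^sup>2)"

abbreviation est_total :: "'a indicator_family \<Rightarrow> 'a set set \<Rightarrow> real" where
  "est_total \<xi> \<T> \<equiv> est \<xi> \<T> \<T>"

definition quadrant :: "(real \<times> real) set" where
  "quadrant = {0..} \<times> {0..}"

text \<open>Functions from the closed quadrant to the nonnegative reals are represented by total functions
  on \<open>real \<times> real\<close> whose values off the quadrant are irrelevant.\<close>

definition null_at_origin :: "(real \<times> real \<Rightarrow> real) \<Rightarrow> bool" where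
  "null_at_origin F \<longleftrightarrow>
     (\<forall>p\<in>quadrant. 0 \<le> F p) \<and> continuous (at (0, 0) within quadrant) F \<and> F (0, 0) = 0"

definition stability_function :: "(real \<times> real \<Rightarrow> real) \<Rightarrow> bool" where
  "stability_function S \<longleftrightarrow>
     null_at_origin S \<and> (\<forall>K. K \<subseteq> quadrant \<longrightarrow> compact K \<longrightarrow> bounded (S ` K))"

definition stability ::
  "('a set set \<Rightarrow> 'a set set \<Rightarrow> 'a set set) \<Rightarrow> 'a set set \<Rightarrow>
   ('a set set \<Rightarrow> 'x::real_normed_vector) \<Rightarrow> ('a set set \<Rightarrow> 'x) \<Rightarrow>
   (real \<times> real \<Rightarrow> real) \<Rightarrow> 'a indicator_family \<Rightarrow> bool" where
  "stability refine \<T>\<^sub>0 u z S \<xi> \<longleftrightarrow>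
     (\<forall>\<T>\<^sub>H \<in> refinements refine \<T>\<^sub>0. \<forall>\<T>\<^sub>h \<in> refinements refine \<T>\<^sub>H.
        est \<xi> \<T>\<^sub>h (\<T>\<^sub>h \<inter> \<T>\<^sub>H)
          \<le> est \<xi> \<T>\<^sub>H (\<T>\<^sub>h \<inter> \<T>\<^sub>H) + S (norm (u \<T>\<^sub>h - u \<T>\<^sub>H), norm (z \<T>\<^sub>h - z \<T>\<^sub>H)))"

definition reduction ::
  "('a set set \<Rightarrow> 'a set set \<Rightarrow> 'a set set) \<Rightarrow> 'a set set \<Rightarrow>
   ('a set set \<Rightarrow> 'x::real_normed_vector) \<Rightarrow> ('a set set \<Rightarrow> 'x) \<Rightarrow>
   real \<Rightarrow> (real \<times> real \<Rightarrow> real) \<Rightarrow> 'a indicator_family \<Rightarrow> bool" where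
  "reduction refine \<T>\<^sub>0 u z q S \<xi> \<longleftrightarrow>
     (\<forall>\<T>\<^sub>H \<in> refinements refine \<T>\<^sub>0. \<forall>\<T>\<^sub>h \<in> refinements refine \<T>\<^sub>H.
        (est \<xi> \<T>\<^sub>h (\<T>\<^sub>h - \<T>\<^sub>H))\<^sup>2
          \<le> q * (est \<xi> \<T>\<^sub>H (\<T>\<^sub>H - \<T>\<^sub>h))\<^sup>2
             + (S (norm (u \<T>\<^sub>h - u \<T>\<^sub>H), norm (z \<T>\<^sub>h - z \<T>\<^sub>H)))\<^sup>2)"

section \<open>Marking strategies and the adaptive algorithm\<close>

definition max_or_zero :: "('b \<Rightarrow> real) \<Rightarrow> 'b set \<Rightarrow> real" where
  "max_or_zero f A = (if A = {} then 0 else Max (f ` A))"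

definition marking_A ::
  "(real \<times> real \<Rightarrow> real) \<Rightarrow> 'a indicator_family \<Rightarrow> 'a indicator_family \<Rightarrow>
   'a set set \<Rightarrow> 'a set set \<Rightarrow> bool" where
  "marking_A V \<eta> \<zeta> \<T> \<M> \<longleftrightarrow>
     max_or_zero (\<eta> \<T>) (\<T> - \<M>) * max_or_zero (\<zeta> \<T>) (\<T> - \<M>)
       \<le> V (est \<eta> \<T> \<M>, est \<zeta> \<T> \<M>)"

definition admissible_W :: "real \<Rightarrow> (real \<times> real \<Rightarrow> real) \<Rightarrow> bool" where
  "admissible_W C\<^sub>W W \<longleftrightarrow>
     0 < C\<^sub>W \<and> (\<forall>p\<in>quadrant. 0 \<le> W p) \<and> W (1, 1) = 1 \<and>
     (\<forall>x\<in>{0..1}. \<forall>y\<in>{0..1}. W (x, y) \<le> C\<^sub>W * max x y)"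

text \<open>The quotients are only used for meshes with nonzero estimator product, see
  \<open>adaptive_algorithm\<close>.\<close>

definition marking_B ::
  "real \<Rightarrow> (real \<times> real \<Rightarrow> real) \<Rightarrow> 'a indicator_family \<Rightarrow> 'a indicator_family \<Rightarrow>
   'a set set \<Rightarrow> 'a set set \<Rightarrow> bool" where
  "marking_B \<theta> W \<eta> \<zeta> \<T> \<M> \<longleftrightarrow>
     \<theta> \<le> W ((est \<eta> \<T> \<M>)\<^sup>2 / (est_total \<eta> \<T>)\<^sup>2, (est \<zeta> \<T> \<M>)\<^sup>2 / (est_total \<zeta> \<T>)\<^sup>2)"

definition adaptive_algorithm ::
  "('a set set \<Rightarrow> 'a set set \<Rightarrow> 'a set set) \<Rightarrow> 'a indicator_family \<Rightarrow> 'a indicator_family \<Rightarrow>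
   ('a set set \<Rightarrow> 'a set set \<Rightarrow> bool) \<Rightarrow> 'a set set \<Rightarrow>
   (nat \<Rightarrow> 'a set set) \<Rightarrow> (nat \<Rightarrow> 'a set set) \<Rightarrow> bool" where
  "adaptive_algorithm refine \<eta> \<zeta> marking \<T>\<^sub>0 \<T> \<M> \<longleftrightarrow>
     \<T> 0 = \<T>\<^sub>0 \<and>
     (\<forall>l. (\<forall>k\<le>l. est_total \<eta> (\<T> k) * est_total \<zeta> (\<T> k) \<noteq> 0) \<longrightarrow>
        \<M> l \<subseteq> \<T> l \<and> marking (\<T> l) (\<M> l) \<and> \<T> (Suc l) = refine (\<T> l) (\<M> l)) \<and>
     (\<forall>l\<^sub>0. est_total \<eta> (\<T> l\<^sub>0) * est_total \<zeta> (\<T> l\<^sub>0) = 0 \<and>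
        (\<forall>k<l\<^sub>0. est_total \<eta> (\<T> k) * est_total \<zeta> (\<T> k) \<noteq> 0) \<longrightarrow>
        (\<forall>l\<ge>l\<^sub>0. \<T> l = \<T> l\<^sub>0))"

definition discrete_subspace :: "'x::real_vector set \<Rightarrow> bool" where
  "discrete_subspace Y \<longleftrightarrow> subspace Y \<and> (\<exists>B. finite B \<and> span B = Y)"

end

theory Submission
  imports Defs
begin

text \<open>
  If the algorithm stops, the product vanishes from some index on. Otherwise the child property
  makes the meshes a sequence in which an element that has disappeared never comes back
  (\<open>never_returns_refinements\<close>): its place is taken by proper subsets of it, and two elements of
  one mesh overlap in a null set only. Call an element persistent if it belongs to all meshes from
  some index on. Since meshes are finite, \<open>\<T> k \<inter> \<T> l\<close> consists, for fixed \<open>l\<close> and all large \<open>k\<close>,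
  of the persistent elements of \<open>\<T> l\<close>.

  Let \<open>r l\<close> be the squared estimator on the non-persistent elements of \<open>\<T> l\<close>. For large \<open>k\<close> such
  elements of \<open>\<T> k\<close> are not in \<open>\<T> l\<close>, so reduction gives \<open>r k \<le> q * r l + \<epsilon>\<close>, where \<open>\<epsilon>\<close> is a
  perturbation that a priori convergence makes small as \<open>l\<close> grows. Hence \<open>r\<close> tends to \<open>0\<close>
  (\<open>est_nonpersistent_tendsto_0\<close>). There are two consequences for each of the two estimators.
  By the marking property, marked elements are not persistent, so the estimator on the marked
  elements tends to \<open>0\<close>. And, again by reduction, up to an arbitrarily small error the
  estimator on \<open>\<T> k\<close> is the one on the elements shared with a fixed mesh \<open>\<T> l\<close>
  (\<open>est_total_le_common\<close>), where \<open>l\<close> is large and \<open>k\<close> is large depending on \<open>l\<close>; with stability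
  it follows that the total estimator stays bounded (\<open>est_total_bounded\<close>).

  With strategy A, the elements shared with \<open>\<T> l\<close> are eventually persistent, hence unmarked, and
  there are at most \<open>card (\<T> l)\<close> of them. The product of the two estimators on them is at most
  \<open>card (\<T> l)\<close> times the product of the maxima over unmarked elements, which tends to \<open>0\<close> since
  \<open>V\<close> is continuous at the origin. With strategy B, in every step one of the two estimators is bounded by a
  constant times its value on the marked elements, and the other one is bounded.
\<close>

section \<open>Meshes and their refinements\<close>

lemma mesh_refinements:
  assumes "refinement_strategy \<Omega> refine" "mesh \<Omega> \<T>" "\<T>' \<in> refinements refine \<T>"
  shows "mesh \<Omega> \<T>'"
  using assms(3) by induction (use assms in \<open>auto simp: refinement_strategy_def\<close>)

lemma refinements_trans:
  assumes "\<T>' \<in> refinements refine \<T>" "\<T>'' \<in> refinements refine \<T>'"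
  shows "\<T>'' \<in> refinements refine \<T>"
  using assms(2) by induction (use assms(1) in \<open>auto intro: refinements.intros\<close>)

lemma mesh_subset_eq:
  assumes "mesh \<Omega> \<T>" "T \<in> \<T>" "T' \<in> \<T>" "T' \<subseteq> T"
  shows "T' = T"
proof (rule ccontr)
  assume "T' \<noteq> T"
  then have "measure lebesgue (T \<inter> T') = 0" "measure lebesgue T' > 0"
    using assms by (auto simp: mesh_def)
  moreover have "T \<inter> T' = T'" using assms by auto
  ultimately show False by simp
qed

lemma refinements_contains_element:
  assumes "refinement_strategy \<Omega> refine" "mesh \<Omega> \<T>\<^sub>0" "child_property refine \<T>\<^sub>0"
    and "\<T> \<in> refinements refine \<T>\<^sub>0" "\<T>' \<in> refinements refine \<T>" "T \<in> \<T>"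
  shows "\<exists>T'\<in>\<T>'. T' \<subseteq> T"
  using assms(5)
proof induction
  case base
  then show ?case using assms(6) by blast
next
  case (step \<T>' \<M>)
  then obtain T' where T': "T' \<in> \<T>'" "T' \<subseteq> T" by blast
  have ref: "\<T>' \<in> refinements refine \<T>\<^sub>0" using refinements_trans assms(4) step(1) .
  have "mesh \<Omega> \<T>'" using mesh_refinements assms(1,2) ref .
  then have "T' \<noteq> {}" using T' by (auto simp: mesh_def)
  moreover have "T' = \<Union>{T'' \<in> refine \<T>' \<M>. T'' \<subseteq> T'}"
    using assms(3) ref step(2) T'(1) unfolding child_property_def by blast
  ultimately obtain T'' where "T'' \<in> refine \<T>' \<M>" "T'' \<subseteq> T'" by blast
  then show ?case using T' by blast
qed

section \<open>Persistent elements\<close>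

text \<open>The elements that belong to all meshes from some index on.\<close>

definition persistent :: "(nat \<Rightarrow> 'b set) \<Rightarrow> 'b set" where
  "persistent \<T> = {T. \<exists>l. \<forall>k\<ge>l. T \<in> \<T> k}"

text \<open>An element that has left the sequence of meshes does not enter it again.\<close>

definition never_returns :: "(nat \<Rightarrow> 'b set) \<Rightarrow> bool" where
  "never_returns \<T> \<longleftrightarrow> (\<forall>l k m. l \<le> k \<longrightarrow> k \<le> m \<longrightarrow> \<T> l \<inter> \<T> m \<subseteq> \<T> k)"

lemma never_returns_refinements:
  assumes strat: "refinement_strategy \<Omega> refine" "mesh \<Omega> \<T>\<^sub>0" "child_property refine \<T>\<^sub>0"
    and ref0: "\<And>l. \<T> l \<in> refinements refine \<T>\<^sub>0"
    and ref: "\<And>l k. l \<le> k \<Longrightarrow> \<T> k \<in> refinements refine (\<T> l)"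
  shows "never_returns \<T>"
  unfolding never_returns_def
proof (intro allI impI subsetI)
  fix l k m :: nat and T
  assume lk: "l \<le> k" and km: "k \<le> m" and T: "T \<in> \<T> l \<inter> \<T> m"
  obtain T' where T': "T' \<in> \<T> k" "T' \<subseteq> T"
    using refinements_contains_element[OF strat ref0 ref[OF lk]] T by blast
  obtain T'' where T'': "T'' \<in> \<T> m" "T'' \<subseteq> T'"
    using refinements_contains_element[OF strat ref0 ref[OF km] T'(1)] by blast
  have "T'' = T"
    using mesh_subset_eq[OF mesh_refinements[OF strat(1,2) ref0]] T T' T'' by blast
  then have "T' = T" using T' T'' by blast
  then show "T \<in> \<T> k" using T' by simp
qed

lemma persistent_Int_removed:
  assumes "never_returns \<T>"
  shows "persistent \<T> \<inter> (\<T> l - \<T> (Suc l)) = {}"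
proof -
  have "T \<in> \<T> (Suc l)" if p: "T \<in> persistent \<T>" and T: "T \<in> \<T> l" for T
  proof -
    obtain m where m: "\<And>k. k \<ge> m \<Longrightarrow> T \<in> \<T> k" using p by (auto simp: persistent_def)
    have "\<T> l \<inter> \<T> (max m (Suc l)) \<subseteq> \<T> (Suc l)"
      using assms unfolding never_returns_def by (meson le_SucI max.cobounded2 order_refl)
    then show ?thesis using m[of "max m (Suc l)"] T by auto
  qed
  then show ?thesis by blast
qed

lemma eventually_Int_persistent:
  assumes "never_returns \<T>" "finite (\<T> l)"
  shows "\<forall>\<^sub>F k in sequentially. \<T> k \<inter> \<T> l = persistent \<T> \<inter> \<T> l"
proof -
  have "\<forall>\<^sub>F k in sequentially. T \<in> \<T> k \<longleftrightarrow> T \<in> persistent \<T>" if T: "T \<in> \<T> l" for T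
  proof (cases "T \<in> persistent \<T>")
    case True
    then show ?thesis by (auto simp: persistent_def eventually_sequentially)
  next
    case False
    then obtain k where k: "k \<ge> l" "T \<notin> \<T> k" by (auto simp: persistent_def)
    have "T \<notin> \<T> m" if "m \<ge> k" for m
      using assms(1) k T that unfolding never_returns_def by blast
    then show ?thesis using False by (auto simp: eventually_sequentially)
  qed
  then have "\<forall>\<^sub>F k in sequentially. \<forall>T\<in>\<T> l. T \<in> \<T> k \<longleftrightarrow> T \<in> persistent \<T>"
    using assms(2) by (intro eventually_ball_finite) auto
  then show ?thesis by (rule eventually_mono) blast
qed

section \<open>Estimators on sets of elements\<close>

lemma est_nonneg [simp]: "0 \<le> est \<xi> \<T> U"
  by (simp add: est_def sum_nonneg)

lemma est_power2: "(est \<xi> \<T> U)\<^sup>2 = (\<Sum>T\<in>U. (\<xi> \<T> T)\<^sup>2)"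
  by (simp add: est_def sum_nonneg)

lemma est_mono:
  assumes "finite U'" "U \<subseteq> U'"
  shows "est \<xi> \<T> U \<le> est \<xi> \<T> U'"
  unfolding est_def using assms by (intro real_sqrt_le_mono sum_mono2) auto

lemma est_le_Int_plus_Diff:
  assumes "finite U"
  shows "est \<xi> \<T> U \<le> est \<xi> \<T> (U \<inter> U') + est \<xi> \<T> (U - U')"
proof (rule power2_le_imp_le)
  have "(est \<xi> \<T> U)\<^sup>2 = (est \<xi> \<T> (U \<inter> U'))\<^sup>2 + (est \<xi> \<T> (U - U'))\<^sup>2"
    unfolding est_power2 by (rule sum.Int_Diff[OF assms])
  also have "\<dots> \<le> (est \<xi> \<T> (U \<inter> U') + est \<xi> \<T> (U - U'))\<^sup>2"
    by (simp add: power2_sum)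
  finally show "(est \<xi> \<T> U)\<^sup>2 \<le> (est \<xi> \<T> (U \<inter> U') + est \<xi> \<T> (U - U'))\<^sup>2" .
qed simp

lemma max_or_zero_ge:
  assumes "finite A" "x \<in> A"
  shows "f x \<le> max_or_zero f A"
  using assms by (auto simp: max_or_zero_def)

lemma max_or_zero_nonneg:
  assumes "finite A" "\<And>x. x \<in> A \<Longrightarrow> 0 \<le> f x"
  shows "0 \<le> max_or_zero f A"
  using assms by (cases "A = {}") (auto simp: max_or_zero_def Max_ge_iff)

lemma est_le_card_max:
  assumes "finite A" "U \<subseteq> A" "\<And>T. T \<in> A \<Longrightarrow> 0 \<le> \<xi> \<T> T" "card U \<le> n"
  shows "est \<xi> \<T> U \<le> sqrt n * max_or_zero (\<xi> \<T>) A"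
proof -
  let ?m = "max_or_zero (\<xi> \<T>) A"
  have m: "0 \<le> ?m" using assms by (intro max_or_zero_nonneg) auto
  have "(\<Sum>T\<in>U. (\<xi> \<T> T)\<^sup>2) \<le> of_nat (card U) * ?m\<^sup>2"
    using assms by (intro sum_bounded_above power_mono max_or_zero_ge) auto
  also have "\<dots> \<le> of_nat n * ?m\<^sup>2" using assms(4) by (intro mult_right_mono) auto
  finally have "est \<xi> \<T> U \<le> sqrt (of_nat n * ?m\<^sup>2)" unfolding est_def by (rule real_sqrt_le_mono)
  then show ?thesis using m by (simp add: real_sqrt_mult)
qed

section \<open>Estimators with stability and reduction along a sequence of meshes\<close>

text \<open>For every \<open>\<epsilon> > 0\<close>, each late term \<open>r l\<close>, contracted and increased by \<open>\<epsilon>\<close>, bounds all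
  sufficiently late terms \<open>r k\<close>; how large \<open>k\<close> must be may depend on \<open>l\<close>. Iteration brings \<open>r\<close>
  eventually below any number that exceeds \<open>\<epsilon> / (1 - q)\<close>.\<close>

lemma perturbed_contraction_tendsto_0:
  fixes r :: "nat \<Rightarrow> real"
  assumes r: "\<And>l. 0 \<le> r l" and q: "0 \<le> q" "q < 1"
    and contr: "\<And>\<epsilon>. 0 < \<epsilon> \<Longrightarrow>
      \<forall>\<^sub>F l in sequentially. \<forall>\<^sub>F k in sequentially. r k \<le> q * r l + \<epsilon>"
  shows "r \<longlonglongrightarrow> 0"
proof (rule order_tendstoI)
  fix a :: real assume "a < 0"
  then show "\<forall>\<^sub>F l in sequentially. a < r l" using r by (auto intro: less_le_trans always_eventually)
next
  fix a :: real assume a: "0 < a"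
  define \<epsilon> where "\<epsilon> = a / 2 * (1 - q)"
  have \<epsilon>: "0 < \<epsilon>" using a q by (simp add: \<epsilon>_def)
  have ev: "\<forall>\<^sub>F l in sequentially. \<forall>\<^sub>F k in sequentially. r k \<le> q * r l + \<epsilon>"
    using contr[OF \<epsilon>] .
  from eventually_happens[OF ev]
  obtain l where l: "\<forall>\<^sub>F k in sequentially. r k \<le> q * r l + \<epsilon>" by auto
  let ?C = "q * r l + \<epsilon>"
  have C: "0 \<le> ?C" using r q \<epsilon> by simp
  (* a / 2 is the fixed point of the map sending x to q x + \<epsilon> *)
  have bound: "\<forall>\<^sub>F k in sequentially. r k \<le> q ^ n * ?C + a / 2" for n
  proof (induction n)
    case 0
    show ?case using l by (rule eventually_mono) (use a in auto)
  next
    case (Suc n)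
    obtain m where m: "r m \<le> q ^ n * ?C + a / 2" "\<forall>\<^sub>F k in sequentially. r k \<le> q * r m + \<epsilon>"
      using eventually_happens[OF eventually_conj[OF Suc ev]] by auto
    have "q * r m + \<epsilon> \<le> q * (q ^ n * ?C + a / 2) + \<epsilon>"
      using m(1) q by (intro add_right_mono mult_left_mono) auto
    also have "\<dots> = q ^ Suc n * ?C + a / 2" by (simp add: \<epsilon>_def field_simps)
    finally show ?case using m(2) by (auto elim: eventually_mono)
  qed
  have "(\<lambda>n. q ^ n * ?C) \<longlonglongrightarrow> 0 * ?C"
    using q by (intro tendsto_intros LIMSEQ_power_zero) auto
  then have "\<forall>\<^sub>F n in sequentially. q ^ n * ?C < a / 2"
    using a by (intro order_tendstoD) auto
  from eventually_happens[OF this] obtain n where n: "q ^ n * ?C < a / 2" by auto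
  show "\<forall>\<^sub>F k in sequentially. r k < a"
    using bound[of n] by (rule eventually_mono) (use n in linarith)
qed

text \<open>Stability and reduction of an indicator family \<open>\<xi>\<close> between any two members of a sequence of
  finite meshes, with a perturbation \<open>\<delta> l k\<close> that tends to \<open>0\<close> with \<open>l\<close>, uniformly in \<open>k \<ge> l\<close>.\<close>

locale stable_reducing_estimator =
  fixes \<T> :: "nat \<Rightarrow> 'a set set" and \<xi> :: "'a set set \<Rightarrow> 'a set \<Rightarrow> real"
    and \<delta> :: "nat \<Rightarrow> nat \<Rightarrow> real" and q :: real
  assumes finite_mesh: "finite (\<T> l)"
    and no_return: "never_returns \<T>"
    and q: "0 \<le> q" "q < 1"
    and \<delta>_nonneg: "0 \<le> \<delta> l k"
    and \<delta>_small: "0 < \<epsilon> \<Longrightarrow> \<forall>\<^sub>F l in sequentially. \<forall>k\<ge>l. \<delta> l k \<le> \<epsilon>"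
    and stable: "l \<le> k \<Longrightarrow>
      est \<xi> (\<T> k) (\<T> k \<inter> \<T> l) \<le> est \<xi> (\<T> l) (\<T> k \<inter> \<T> l) + \<delta> l k"
    and reducing: "l \<le> k \<Longrightarrow>
      (est \<xi> (\<T> k) (\<T> k - \<T> l))\<^sup>2 \<le> q * (est \<xi> (\<T> l) (\<T> l - \<T> k))\<^sup>2 + (\<delta> l k)\<^sup>2"
begin

lemma est_new_elements:
  assumes "0 < \<epsilon>"
  shows "\<forall>\<^sub>F l in sequentially. \<forall>\<^sub>F k in sequentially.
    (est \<xi> (\<T> k) (\<T> k - \<T> l))\<^sup>2 \<le> q * (est \<xi> (\<T> l) (\<T> l - persistent \<T>))\<^sup>2 + \<epsilon>"
proof -
  have "\<forall>\<^sub>F l in sequentially. \<forall>k\<ge>l. \<delta> l k \<le> sqrt \<epsilon>" using assms by (intro \<delta>_small) simp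
  then show ?thesis
  proof (rule eventually_mono)
    fix l assume l: "\<forall>k\<ge>l. \<delta> l k \<le> sqrt \<epsilon>"
    show "\<forall>\<^sub>F k in sequentially.
      (est \<xi> (\<T> k) (\<T> k - \<T> l))\<^sup>2 \<le> q * (est \<xi> (\<T> l) (\<T> l - persistent \<T>))\<^sup>2 + \<epsilon>"
      using eventually_Int_persistent[of \<T> l, OF no_return finite_mesh] eventually_ge_at_top[of l]
    proof eventually_elim
      case (elim k)
      have "\<T> l - \<T> k = \<T> l - persistent \<T>" using elim by blast
      moreover have "(\<delta> l k)\<^sup>2 \<le> (sqrt \<epsilon>)\<^sup>2"
        using l elim \<delta>_nonneg by (intro power_mono) auto
      ultimately show ?case using reducing[OF elim(2)] assms by simp
    qed
  qed
qed

lemma est_nonpersistent_tendsto_0: "(\<lambda>l. est \<xi> (\<T> l) (\<T> l - persistent \<T>)) \<longlonglongrightarrow> 0"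
proof -
  have "(\<lambda>l. (est \<xi> (\<T> l) (\<T> l - persistent \<T>))\<^sup>2) \<longlonglongrightarrow> 0"
  proof (rule perturbed_contraction_tendsto_0[OF _ q])
    fix \<epsilon> :: real assume "0 < \<epsilon>"
    from est_new_elements[OF this]
    show "\<forall>\<^sub>F l in sequentially. \<forall>\<^sub>F k in sequentially.
      (est \<xi> (\<T> k) (\<T> k - persistent \<T>))\<^sup>2 \<le> q * (est \<xi> (\<T> l) (\<T> l - persistent \<T>))\<^sup>2 + \<epsilon>"
    proof (rule eventually_mono)
      fix l assume l: "\<forall>\<^sub>F k in sequentially.
        (est \<xi> (\<T> k) (\<T> k - \<T> l))\<^sup>2 \<le> q * (est \<xi> (\<T> l) (\<T> l - persistent \<T>))\<^sup>2 + \<epsilon>"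
      show "\<forall>\<^sub>F k in sequentially.
        (est \<xi> (\<T> k) (\<T> k - persistent \<T>))\<^sup>2 \<le> q * (est \<xi> (\<T> l) (\<T> l - persistent \<T>))\<^sup>2 + \<epsilon>"
        using l eventually_Int_persistent[of \<T> l, OF no_return finite_mesh]
      proof eventually_elim
        case (elim k)
        have "\<T> k - persistent \<T> \<subseteq> \<T> k - \<T> l" using elim(2) by blast
        then have "(est \<xi> (\<T> k) (\<T> k - persistent \<T>))\<^sup>2 \<le> (est \<xi> (\<T> k) (\<T> k - \<T> l))\<^sup>2"
          using finite_mesh by (intro power_mono est_mono) auto
        then show ?case using elim(1) by linarith
      qed
    qed
  qed simp
  then have "(\<lambda>l. sqrt ((est \<xi> (\<T> l) (\<T> l - persistent \<T>))\<^sup>2)) \<longlonglongrightarrow> sqrt 0"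
    by (rule tendsto_real_sqrt)
  then show ?thesis by simp
qed

lemma est_removed_tendsto_0:
  assumes "\<And>l. \<M> l \<subseteq> \<T> l - \<T> (Suc l)"
  shows "(\<lambda>l. est \<xi> (\<T> l) (\<M> l)) \<longlonglongrightarrow> 0"
proof (rule tendsto_sandwich[OF _ _ tendsto_const est_nonpersistent_tendsto_0])
  have "est \<xi> (\<T> l) (\<M> l) \<le> est \<xi> (\<T> l) (\<T> l - persistent \<T>)" for l
    using assms[of l] persistent_Int_removed[OF no_return, of l] finite_mesh
    by (intro est_mono) auto
  then show "\<forall>\<^sub>F l in sequentially.
    est \<xi> (\<T> l) (\<M> l) \<le> est \<xi> (\<T> l) (\<T> l - persistent \<T>)" by simp
qed simp

lemma est_total_le_common:
  assumes \<epsilon>: "0 < \<epsilon>"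
  shows "\<forall>\<^sub>F l in sequentially. \<forall>\<^sub>F k in sequentially.
    est_total \<xi> (\<T> k) \<le> est \<xi> (\<T> k) (\<T> k \<inter> \<T> l) + \<epsilon>"
proof -
  have "(\<lambda>l. q * (est \<xi> (\<T> l) (\<T> l - persistent \<T>))\<^sup>2) \<longlonglongrightarrow> q * 0\<^sup>2"
    by (intro tendsto_intros est_nonpersistent_tendsto_0)
  then have small: "\<forall>\<^sub>F l in sequentially. q * (est \<xi> (\<T> l) (\<T> l - persistent \<T>))\<^sup>2 < \<epsilon>\<^sup>2 / 2"
    using \<epsilon> by (intro order_tendstoD) auto
  have "0 < \<epsilon>\<^sup>2 / 2" using \<epsilon> by simp
  from small est_new_elements[OF this] show ?thesis
  proof eventually_elim
    case (elim l)
    from elim(2) show ?case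
    proof (rule eventually_mono)
      fix k
      assume "(est \<xi> (\<T> k) (\<T> k - \<T> l))\<^sup>2
        \<le> q * (est \<xi> (\<T> l) (\<T> l - persistent \<T>))\<^sup>2 + \<epsilon>\<^sup>2 / 2"
      then have "(est \<xi> (\<T> k) (\<T> k - \<T> l))\<^sup>2 \<le> \<epsilon>\<^sup>2" using elim(1) by linarith
      then have "est \<xi> (\<T> k) (\<T> k - \<T> l) \<le> \<epsilon>" by (rule power2_le_imp_le) (use \<epsilon> in simp)
      then show "est_total \<xi> (\<T> k) \<le> est \<xi> (\<T> k) (\<T> k \<inter> \<T> l) + \<epsilon>"
        using est_le_Int_plus_Diff[OF finite_mesh, of \<xi> "\<T> k" k "\<T> l"] by linarith
    qed
  qed
qed

lemma est_total_bounded: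
  obtains C where "0 \<le> C" "\<forall>\<^sub>F k in sequentially. est_total \<xi> (\<T> k) \<le> C"
proof -
  obtain l where l: "\<forall>\<^sub>F k in sequentially. est_total \<xi> (\<T> k) \<le> est \<xi> (\<T> k) (\<T> k \<inter> \<T> l) + 1"
    "\<forall>k\<ge>l. \<delta> l k \<le> 1"
    using eventually_happens[OF eventually_conj[OF est_total_le_common[OF zero_less_one]
        \<delta>_small[OF zero_less_one]]] by auto
  have "\<forall>\<^sub>F k in sequentially. est_total \<xi> (\<T> k) \<le> est_total \<xi> (\<T> l) + 2"
    using l(1) eventually_ge_at_top[of l]
  proof eventually_elim
    case (elim k)
    have "est \<xi> (\<T> l) (\<T> k \<inter> \<T> l) \<le> est_total \<xi> (\<T> l)"
      by (intro est_mono finite_mesh) auto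
    then show ?case using elim stable[OF elim(2)] l(2)[rule_format, OF elim(2)] by linarith
  qed
  then show ?thesis using that[of "est_total \<xi> (\<T> l) + 2"] by simp
qed

end

section \<open>The two marking strategies\<close>

text \<open>Two estimators along the same sequence of meshes, with marked elements that are removed in
  the next step.\<close>

locale marked_estimator_pair =
  \<eta>: stable_reducing_estimator \<T> \<eta> \<delta> q + \<zeta>: stable_reducing_estimator \<T> \<zeta> \<delta> q
  for \<T> :: "nat \<Rightarrow> 'a set set" and \<eta> \<zeta> :: "'a set set \<Rightarrow> 'a set \<Rightarrow> real"
    and \<delta> :: "nat \<Rightarrow> nat \<Rightarrow> real" and q :: real +
  fixes \<M> :: "nat \<Rightarrow> 'a set set"
  assumes marked_removed: "\<M> l \<subseteq> \<T> l - \<T> (Suc l)"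
begin

lemma est_product_tendsto_0_marking_A:
  assumes V: "null_at_origin V"
    and marking: "\<And>l. marking_A V \<eta> \<zeta> (\<T> l) (\<M> l)"
    and nonneg: "\<And>l T. T \<in> \<T> l \<Longrightarrow> 0 \<le> \<eta> (\<T> l) T \<and> 0 \<le> \<zeta> (\<T> l) T"
  shows "(\<lambda>l. est_total \<eta> (\<T> l) * est_total \<zeta> (\<T> l)) \<longlonglongrightarrow> 0"
proof (rule order_tendstoI)
  fix a :: real assume "a < 0"
  then show "\<forall>\<^sub>F l in sequentially. a < est_total \<eta> (\<T> l) * est_total \<zeta> (\<T> l)"
    by (auto intro!: always_eventually intro: less_le_trans mult_nonneg_nonneg)
next
  fix a :: real assume a: "0 < a"
  define v where "v l = V (est \<eta> (\<T> l) (\<M> l), est \<zeta> (\<T> l) (\<M> l))" for l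
  have v: "v \<longlonglongrightarrow> 0"
  proof -
    have "((\<lambda>l. (est \<eta> (\<T> l) (\<M> l), est \<zeta> (\<T> l) (\<M> l))) \<longlongrightarrow> (0, 0)) sequentially"
      by (intro tendsto_Pair \<eta>.est_removed_tendsto_0 \<zeta>.est_removed_tendsto_0 marked_removed)
    moreover have "continuous (at (0, 0) within quadrant) V" "V (0, 0) = 0"
      using V by (auto simp: null_at_origin_def)
    ultimately show ?thesis
      unfolding v_def
      using continuous_within_tendsto_compose'[of "(0, 0)" quadrant V
          "\<lambda>l. (est \<eta> (\<T> l) (\<M> l), est \<zeta> (\<T> l) (\<M> l))" sequentially]
      by (auto simp: quadrant_def)
  qed
  obtain C where C: "0 \<le> C" "\<forall>\<^sub>F k in sequentially. est_total \<eta> (\<T> k) \<le> C"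
    by (rule \<eta>.est_total_bounded)
  obtain D where D: "0 \<le> D" "\<forall>\<^sub>F k in sequentially. est_total \<zeta> (\<T> k) \<le> D"
    by (rule \<zeta>.est_total_bounded)
  (* chosen so that (C + D) * \<epsilon> < a / 2 *)
  define \<epsilon> where "\<epsilon> = a / (2 * (C + D + 1))"
  have \<epsilon>: "0 < \<epsilon>" using a C D by (simp add: \<epsilon>_def)
  have \<epsilon>a: "(C + D) * \<epsilon> < a / 2" using a C D by (simp add: \<epsilon>_def field_simps)
  from eventually_happens[OF eventually_conj[OF \<eta>.est_total_le_common[OF \<epsilon>]
      \<zeta>.est_total_le_common[OF \<epsilon>]]]
  obtain L where L:
    "\<forall>\<^sub>F k in sequentially. est_total \<eta> (\<T> k) \<le> est \<eta> (\<T> k) (\<T> k \<inter> \<T> L) + \<epsilon>"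
    "\<forall>\<^sub>F k in sequentially. est_total \<zeta> (\<T> k) \<le> est \<zeta> (\<T> k) (\<T> k \<inter> \<T> L) + \<epsilon>"
    by auto
  let ?n = "card (\<T> L)"
  have "(\<lambda>k. real ?n * v k) \<longlonglongrightarrow> real ?n * 0" by (intro tendsto_intros v)
  then have "\<forall>\<^sub>F k in sequentially. real ?n * v k < a / 2"
    using a by (intro order_tendstoD) auto
  with C(2) D(2) L eventually_Int_persistent[of \<T> L, OF \<eta>.no_return \<eta>.finite_mesh]
  show "\<forall>\<^sub>F k in sequentially. est_total \<eta> (\<T> k) * est_total \<zeta> (\<T> k) < a"
  proof eventually_elim
    case (elim k)
    let ?F = "\<T> k \<inter> \<T> L"
    let ?U = "\<T> k - \<M> k"
    have U: "finite ?U" "?F \<subseteq> ?U"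
      using elim(5) \<eta>.finite_mesh marked_removed[of k]
        persistent_Int_removed[OF \<eta>.no_return, of k] by auto
    have F: "card ?F \<le> ?n" by (intro card_mono \<eta>.finite_mesh) auto
    have "est \<eta> (\<T> k) ?F * est \<zeta> (\<T> k) ?F
      \<le> (sqrt ?n * max_or_zero (\<eta> (\<T> k)) ?U) * (sqrt ?n * max_or_zero (\<zeta> (\<T> k)) ?U)"
      using nonneg[of _ k] U F
      by (intro mult_mono est_le_card_max mult_nonneg_nonneg max_or_zero_nonneg) auto
    also have "\<dots> = ?n * (max_or_zero (\<eta> (\<T> k)) ?U * max_or_zero (\<zeta> (\<T> k)) ?U)"
      by (simp add: algebra_simps)
    also have "\<dots> \<le> ?n * v k"
      using marking[of k] unfolding marking_A_def v_def by (intro mult_left_mono) auto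
    finally have FF: "est \<eta> (\<T> k) ?F * est \<zeta> (\<T> k) ?F < a / 2" using elim(6) by linarith
    have FD: "est \<eta> (\<T> k) ?F \<le> C"
      using elim(1) est_mono[OF \<eta>.finite_mesh, of ?F k \<eta> "\<T> k"] by simp
    have "est_total \<eta> (\<T> k) * est_total \<zeta> (\<T> k) \<le>
      est \<eta> (\<T> k) ?F * est_total \<zeta> (\<T> k) + \<epsilon> * est_total \<zeta> (\<T> k)"
      using mult_right_mono[OF elim(3), of "est_total \<zeta> (\<T> k)"] by (simp add: algebra_simps)
    also have "est \<eta> (\<T> k) ?F * est_total \<zeta> (\<T> k)
      \<le> est \<eta> (\<T> k) ?F * est \<zeta> (\<T> k) ?F + est \<eta> (\<T> k) ?F * \<epsilon>"
      using mult_left_mono[OF elim(4), of "est \<eta> (\<T> k) ?F"] by (simp add: algebra_simps)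
    also have "est \<eta> (\<T> k) ?F * \<epsilon> \<le> C * \<epsilon>" using FD \<epsilon> by simp
    also have "\<epsilon> * est_total \<zeta> (\<T> k) \<le> \<epsilon> * D" using elim(2) \<epsilon> by simp
    finally show ?case using FF \<epsilon>a by (simp add: algebra_simps)
  qed
qed

lemma est_product_tendsto_0_marking_B:
  assumes \<theta>: "0 < \<theta>" and W: "admissible_W C\<^sub>W W"
    and marking: "\<And>l. marking_B \<theta> W \<eta> \<zeta> (\<T> l) (\<M> l)"
    and nonzero: "\<And>l. est_total \<eta> (\<T> l) \<noteq> 0" "\<And>l. est_total \<zeta> (\<T> l) \<noteq> 0"
  shows "(\<lambda>l. est_total \<eta> (\<T> l) * est_total \<zeta> (\<T> l)) \<longlonglongrightarrow> 0"
proof -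
  have CW: "0 < C\<^sub>W" using W by (simp add: admissible_W_def)
  define K where "K = sqrt (C\<^sub>W / \<theta>)"
  have K: "0 \<le> K" "K\<^sup>2 = C\<^sub>W / \<theta>" using CW \<theta> by (auto simp: K_def)
  have ratio: "(est \<xi> (\<T> l) (\<M> l))\<^sup>2 / (est_total \<xi> (\<T> l))\<^sup>2 \<in> {0..1}" for \<xi> l
  proof -
    have "est \<xi> (\<T> l) (\<M> l) \<le> est_total \<xi> (\<T> l)"
      using marked_removed[of l] by (intro est_mono \<eta>.finite_mesh) auto
    then have "(est \<xi> (\<T> l) (\<M> l))\<^sup>2 \<le> (est_total \<xi> (\<T> l))\<^sup>2" by (intro power_mono) auto
    then show ?thesis by (auto simp: divide_le_eq_1)
  qed
  have dominated: "est_total \<xi> (\<T> l) \<le> K * est \<xi> (\<T> l) (\<M> l)"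
    if "\<theta> \<le> C\<^sub>W * ((est \<xi> (\<T> l) (\<M> l))\<^sup>2 / (est_total \<xi> (\<T> l))\<^sup>2)"
      and "est_total \<xi> (\<T> l) \<noteq> 0" for \<xi> l
  proof (rule power2_le_imp_le)
    show "(est_total \<xi> (\<T> l))\<^sup>2 \<le> (K * est \<xi> (\<T> l) (\<M> l))\<^sup>2"
      using that \<theta> by (simp add: power_mult_distrib K field_simps)
  qed (use K in simp)
  have alt: "est_total \<eta> (\<T> l) \<le> K * est \<eta> (\<T> l) (\<M> l) \<or>
    est_total \<zeta> (\<T> l) \<le> K * est \<zeta> (\<T> l) (\<M> l)" for l
  proof -
    let ?x = "(est \<eta> (\<T> l) (\<M> l))\<^sup>2 / (est_total \<eta> (\<T> l))\<^sup>2"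
    let ?y = "(est \<zeta> (\<T> l) (\<M> l))\<^sup>2 / (est_total \<zeta> (\<T> l))\<^sup>2"
    have "\<theta> \<le> W (?x, ?y)" using marking[of l] by (simp add: marking_B_def)
    also have "\<dots> \<le> C\<^sub>W * max ?x ?y"
      using W ratio[of \<eta> l] ratio[of \<zeta> l] unfolding admissible_W_def by blast
    finally have "\<theta> \<le> C\<^sub>W * ?x \<or> \<theta> \<le> C\<^sub>W * ?y" by (auto simp: max_def split: if_splits)
    then show ?thesis using dominated nonzero by blast
  qed
  obtain C where C: "0 \<le> C" "\<forall>\<^sub>F k in sequentially. est_total \<eta> (\<T> k) \<le> C"
    by (rule \<eta>.est_total_bounded)
  obtain D where D: "0 \<le> D" "\<forall>\<^sub>F k in sequentially. est_total \<zeta> (\<T> k) \<le> D"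
    by (rule \<zeta>.est_total_bounded)
  let ?b = "\<lambda>l. D * (K * est \<eta> (\<T> l) (\<M> l)) + C * (K * est \<zeta> (\<T> l) (\<M> l))"
  have "?b \<longlonglongrightarrow> D * (K * 0) + C * (K * 0)"
    by (intro tendsto_intros \<eta>.est_removed_tendsto_0 \<zeta>.est_removed_tendsto_0 marked_removed)
  then have b: "?b \<longlonglongrightarrow> 0" by simp
  have "\<forall>\<^sub>F l in sequentially. est_total \<eta> (\<T> l) * est_total \<zeta> (\<T> l) \<le> ?b l"
    using C(2) D(2)
  proof eventually_elim
    case (elim l)
    have nn: "0 \<le> D * (K * est \<eta> (\<T> l) (\<M> l))" "0 \<le> C * (K * est \<zeta> (\<T> l) (\<M> l))"
      using C D K by auto
    from alt[of l] show ?case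
    proof
      assume "est_total \<eta> (\<T> l) \<le> K * est \<eta> (\<T> l) (\<M> l)"
      then have "est_total \<zeta> (\<T> l) * est_total \<eta> (\<T> l) \<le> D * (K * est \<eta> (\<T> l) (\<M> l))"
        using elim D K by (intro mult_mono) auto
      then show ?thesis using nn by (simp add: mult.commute)
    next
      assume "est_total \<zeta> (\<T> l) \<le> K * est \<zeta> (\<T> l) (\<M> l)"
      then have "est_total \<eta> (\<T> l) * est_total \<zeta> (\<T> l) \<le> C * (K * est \<zeta> (\<T> l) (\<M> l))"
        using elim C K by (intro mult_mono) auto
      then show ?thesis using nn by simp
    qed
  qed
  then show ?thesis
    by (intro tendsto_sandwich[OF _ _ tendsto_const b]) auto
qed

end

section \<open>Convergence of the adaptive algorithm\<close>

lemma adaptive_algorithm_stopped: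
  assumes "adaptive_algorithm refine \<eta> \<zeta> marking \<T>\<^sub>0 \<T> \<M>"
    and "est_total \<eta> (\<T> l) * est_total \<zeta> (\<T> l) = 0"
  shows "(\<lambda>l. est_total \<eta> (\<T> l) * est_total \<zeta> (\<T> l)) \<longlonglongrightarrow> 0"
proof -
  let ?P = "\<lambda>l. est_total \<eta> (\<T> l) * est_total \<zeta> (\<T> l) = 0"
  define l0 where "l0 = (LEAST l. ?P l)"
  have l0: "?P l0" unfolding l0_def using assms(2) by (rule LeastI)
  have "\<forall>k<l0. \<not> ?P k" unfolding l0_def using not_less_Least by blast
  then have "\<T> l = \<T> l0" if "l \<ge> l0" for l
    using assms(1) l0 that unfolding adaptive_algorithm_def by blast
  then have "?P l" if "l \<ge> l0" for l using l0 that by metis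
  then have "\<forall>\<^sub>F l in sequentially. ?P l" by (auto simp: eventually_sequentially)
  then show ?thesis by (rule tendsto_eventually)
qed

text \<open>The perturbation in stability and reduction vanishes by a priori convergence, as the
  differences of discrete solutions form Cauchy sequences.\<close>

lemma null_at_origin_differences_small:
  fixes a b :: "nat \<Rightarrow> 'x::real_normed_vector"
  assumes S: "null_at_origin S"
    and a: "(\<lambda>l. norm (a_inf - a l)) \<longlonglongrightarrow> 0" and b: "(\<lambda>l. norm (b_inf - b l)) \<longlonglongrightarrow> 0"
    and \<epsilon>: "0 < \<epsilon>"
  shows "\<forall>\<^sub>F l in sequentially. \<forall>k\<ge>l. S (norm (a k - a l), norm (b k - b l)) \<le> \<epsilon>"
proof -
  have "\<forall>\<^sub>F p in at (0, 0) within quadrant. dist (S p) 0 < \<epsilon>"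
    using S \<epsilon> unfolding null_at_origin_def continuous_within by (metis tendstoD)
  then obtain d where d: "0 < d"
    "\<And>p. p \<in> quadrant \<Longrightarrow> p \<noteq> (0, 0) \<Longrightarrow> dist p (0, 0) < d \<Longrightarrow> dist (S p) 0 < \<epsilon>"
    by (auto simp: eventually_at)
  have Sd: "S p \<le> \<epsilon>" if "p \<in> quadrant" "dist p (0, 0) < d" for p
  proof (cases "p = (0, 0)")
    case True
    then show ?thesis using S \<epsilon> by (simp add: null_at_origin_def)
  next
    case False
    then show ?thesis using d(2)[OF that(1) _ that(2)] by (simp add: dist_real_def)
  qed
  (* the two triangle inequalities and the passage to the norm of the pair each cost a factor 2 *)
  have "\<forall>\<^sub>F l in sequentially. norm (a_inf - a l) < d / 4"
    by (rule order_tendstoD(2)[OF a]) (use d(1) in simp)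
  moreover have "\<forall>\<^sub>F l in sequentially. norm (b_inf - b l) < d / 4"
    by (rule order_tendstoD(2)[OF b]) (use d(1) in simp)
  ultimately have "\<forall>\<^sub>F l in sequentially. norm (a_inf - a l) < d / 4 \<and> norm (b_inf - b l) < d / 4"
    by (rule eventually_conj)
  from eventually_all_ge_at_top[OF this]
  show ?thesis
  proof (rule eventually_mono, intro allI impI)
    fix l k :: nat
    assume *: "\<forall>k\<ge>l. norm (a_inf - a k) < d / 4 \<and> norm (b_inf - b k) < d / 4" and k: "l \<le> k"
    have "norm (a k - a l) \<le> norm (a_inf - a l) + norm (a_inf - a k)"
      using norm_triangle_ineq4[of "a_inf - a l" "a_inf - a k"] by simp
    then have da: "norm (a k - a l) < d / 2"
      using *[rule_format, of l] *[rule_format, OF k] by simp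
    have "norm (b k - b l) \<le> norm (b_inf - b l) + norm (b_inf - b k)"
      using norm_triangle_ineq4[of "b_inf - b l" "b_inf - b k"] by simp
    then have db: "norm (b k - b l) < d / 2"
      using *[rule_format, of l] *[rule_format, OF k] by simp
    have "dist (norm (a k - a l), norm (b k - b l)) (0, 0)
      \<le> norm (a k - a l) + norm (b k - b l)"
      using sqrt_sum_squares_le_sum[of "norm (a k - a l)" "norm (b k - b l)"]
      by (simp add: dist_Pair_Pair dist_real_def)
    then show "S (norm (a k - a l), norm (b k - b l)) \<le> \<epsilon>"
      using da db by (intro Sd) (auto simp: quadrant_def)
  qed
qed

theorem mainTheorem2:
  fixes \<Omega> :: "'a::euclidean_space set"
    and refine :: "'a set set \<Rightarrow> 'a set set \<Rightarrow> 'a set set"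
    and \<T>\<^sub>0 :: "'a set set"
    and X :: "'a set set \<Rightarrow> 'x::real_normed_vector set"
    and u z :: "'a set set \<Rightarrow> 'x"
    and \<eta> \<zeta> :: "'a set set \<Rightarrow> 'a set \<Rightarrow> real"
    and u_exact :: 'x
    and G :: "'x \<Rightarrow> real"
    and G_disc :: "'a set set \<Rightarrow> real"
    and C_go q_red :: real
    and S :: "real \<times> real \<Rightarrow> real"
    and \<T> \<M> :: "nat \<Rightarrow> 'a set set"
  assumes domain: "bounded_lipschitz_domain \<Omega>" "measure lebesgue \<Omega> > 0"
    and refine: "refinement_strategy \<Omega> refine"
    and initial: "mesh \<Omega> \<T>\<^sub>0"
    and discrete: "\<And>\<T>\<^sub>H. \<T>\<^sub>H \<in> refinements refine \<T>\<^sub>0 \<Longrightarrow>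
          discrete_subspace (X \<T>\<^sub>H) \<and> u \<T>\<^sub>H \<in> X \<T>\<^sub>H \<and> z \<T>\<^sub>H \<in> X \<T>\<^sub>H"
    and indicators: "\<And>\<T>\<^sub>H T. \<T>\<^sub>H \<in> refinements refine \<T>\<^sub>0 \<Longrightarrow> T \<in> \<T>\<^sub>H \<Longrightarrow>
          0 \<le> \<eta> \<T>\<^sub>H T \<and> 0 \<le> \<zeta> \<T>\<^sub>H T"
    and goal: "continuous_on UNIV G" "C_go > 0"
          "\<And>\<T>\<^sub>H. \<T>\<^sub>H \<in> refinements refine \<T>\<^sub>0 \<Longrightarrow>
             \<bar>G u_exact - G_disc \<T>\<^sub>H\<bar> \<le> C_go * (est_total \<eta> \<T>\<^sub>H * est_total \<zeta> \<T>\<^sub>H)"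
    and algorithm:
      "(\<exists>V. null_at_origin V \<and>
            adaptive_algorithm refine \<eta> \<zeta> (marking_A V \<eta> \<zeta>) \<T>\<^sub>0 \<T> \<M>) \<or>
       (\<exists>\<theta> W C\<^sub>W. 0 < \<theta> \<and> \<theta> \<le> 1 \<and> admissible_W C\<^sub>W W \<and>
            adaptive_algorithm refine \<eta> \<zeta> (marking_B \<theta> W \<eta> \<zeta>) \<T>\<^sub>0 \<T> \<M>)"
    and q_red: "0 < q_red" "q_red < 1"
    and S: "stability_function S"
    and stability: "stability refine \<T>\<^sub>0 u z S \<eta>" "stability refine \<T>\<^sub>0 u z S \<zeta>"
    and reduction: "reduction refine \<T>\<^sub>0 u z q_red S \<eta>" "reduction refine \<T>\<^sub>0 u z q_red S \<zeta>"
    and marking: "marking_property refine \<T>\<^sub>0"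
    and child: "child_property refine \<T>\<^sub>0"
    and a_priori:
      "\<exists>u_inf. (\<lambda>l. norm (u_inf - u (\<T> l))) \<longlonglongrightarrow> 0"
      "\<exists>z_inf. (\<lambda>l. norm (z_inf - z (\<T> l))) \<longlonglongrightarrow> 0"
  shows "(\<lambda>l. est_total \<eta> (\<T> l) * est_total \<zeta> (\<T> l)) \<longlonglongrightarrow> 0"
proof -
  obtain marking_strategy where alg: "adaptive_algorithm refine \<eta> \<zeta> marking_strategy \<T>\<^sub>0 \<T> \<M>"
    using algorithm by blast
  show ?thesis
  proof (cases "\<exists>l. est_total \<eta> (\<T> l) * est_total \<zeta> (\<T> l) = 0")
    case True
    then show ?thesis using adaptive_algorithm_stopped[OF alg] by blast
  next
    case False
    have marks: "strategy (\<T> l) (\<M> l)"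
      if "adaptive_algorithm refine \<eta> \<zeta> strategy \<T>\<^sub>0 \<T> \<M>" for strategy l
      using that False unfolding adaptive_algorithm_def by blast
    have sub: "\<M> l \<subseteq> \<T> l" and next_mesh: "\<T> (Suc l) = refine (\<T> l) (\<M> l)" for l
      using alg False unfolding adaptive_algorithm_def by blast+
    have ref: "\<T> k \<in> refinements refine (\<T> l)" if "l \<le> k" for l k
      using that
      by (induction k rule: dec_induct)
        (simp_all add: next_mesh refinements.base refinements.step[OF _ sub])
    have "\<T> 0 = \<T>\<^sub>0" using alg by (simp add: adaptive_algorithm_def)
    then have ref0: "\<T> l \<in> refinements refine \<T>\<^sub>0" for l using ref[of 0 l] by simp
    have fin: "finite (\<T> l)" for l
      using mesh_refinements[OF refine initial ref0] by (simp add: mesh_def)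
    have no_return: "never_returns \<T>"
      using never_returns_refinements[OF refine initial child ref0 ref] .
    have removed: "\<M> l \<subseteq> \<T> l - \<T> (Suc l)" for l
      using marking ref0[of l] sub[of l] unfolding marking_property_def next_mesh by blast
    define \<delta> where
      "\<delta> l k = S (norm (u (\<T> k) - u (\<T> l)), norm (z (\<T> k) - z (\<T> l)))" for l k
    have S0: "null_at_origin S" using S by (simp add: stability_function_def)
    have \<delta>_nonneg: "0 \<le> \<delta> l k" for l k
      using S0 by (auto simp: \<delta>_def null_at_origin_def quadrant_def)
    obtain u_inf z_inf where limits: "(\<lambda>l. norm (u_inf - u (\<T> l))) \<longlonglongrightarrow> 0"
      "(\<lambda>l. norm (z_inf - z (\<T> l))) \<longlonglongrightarrow> 0"
      using a_priori by blast
    have \<delta>_small: "\<forall>\<^sub>F l in sequentially. \<forall>k\<ge>l. \<delta> l k \<le> \<epsilon>" if "0 < \<epsilon>" for \<epsilon>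
      unfolding \<delta>_def using null_at_origin_differences_small[OF S0 limits that] .
    have estimator: "stable_reducing_estimator \<T> \<xi> \<delta> q_red"
      if \<xi>: "stability refine \<T>\<^sub>0 u z S \<xi>" "reduction refine \<T>\<^sub>0 u z q_red S \<xi>" for \<xi>
    proof (rule stable_reducing_estimator.intro)
      show "0 \<le> q_red" "q_red < 1" using q_red by simp_all
      show "est \<xi> (\<T> k) (\<T> k \<inter> \<T> l) \<le> est \<xi> (\<T> l) (\<T> k \<inter> \<T> l) + \<delta> l k" if "l \<le> k" for l k
        using \<xi>(1) ref0[of l] ref[OF that] unfolding stability_def \<delta>_def by blast
      show "(est \<xi> (\<T> k) (\<T> k - \<T> l))\<^sup>2 \<le> q_red * (est \<xi> (\<T> l) (\<T> l - \<T> k))\<^sup>2 + (\<delta> l k)\<^sup>2"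
        if "l \<le> k" for l k
        using \<xi>(2) ref0[of l] ref[OF that] unfolding reduction_def \<delta>_def by blast
    qed (fact fin no_return \<delta>_nonneg \<delta>_small)+
    interpret marked_estimator_pair \<T> \<eta> \<zeta> \<delta> q_red \<M>
      by (intro marked_estimator_pair.intro marked_estimator_pair_axioms.intro
          estimator stability reduction removed)
    show ?thesis
      using algorithm
    proof (elim disjE exE conjE)
      fix V
      assume "null_at_origin V" "adaptive_algorithm refine \<eta> \<zeta> (marking_A V \<eta> \<zeta>) \<T>\<^sub>0 \<T> \<M>"
      then show ?thesis
        using marks indicators ref0 by (intro est_product_tendsto_0_marking_A) auto
    next
      fix \<theta> W C\<^sub>W
      assume "0 < \<theta>" "admissible_W C\<^sub>W W"
        "adaptive_algorithm refine \<eta> \<zeta> (marking_B \<theta> W \<eta> \<zeta>) \<T>\<^sub>0 \<T> \<M>"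
      then show ?thesis
        using marks False by (intro est_product_tendsto_0_marking_B) auto
    qed
  qed
qed

end
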